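(* Let $(X,T)$ be a transitive cascade. (1) If $(X,T)$ is weakly rigid, or, more generally, if $(X\times X,T\times T)$ is pointwise recurrent, then $X$ does not admit a nonempty proper isolated, closed, invariant subset. (2) If $(X,T)$ is weakly rigid and weakly mixing, then $X$ is connected.
   Context: A cascade $(X,T)$ is a homeomorphism $T$ of a compact Hausdorff space $X$ (not necessarily metrizable). A subset $A\subset X$ is invariant if $T(A)=A$. The cascade is transitive if for all nonempty open $U,V\subset X$ there is $i\in\mathbb{Z}$ with $U\cap T^{-i}(V)\neq\emptyset$; it is weakly mixing if $(X\times X,T\times T)$ is transitive. For a cascade $(Y,S)$ and $y\in Y$, let $\omega(y)=\bigcap_{N\ge 1}\overline{\{S^i y: i\ge N\}}$ and $\alpha(y)=\bigcap_{N\ge1}\overline{\{S^{i}y: i\le -N\}}$. A point $y$ is recurrent if $y\in\alpha(y)\cup\omega(y)$. $(Y,S)$ is pointwise recurrent if every point of $Y$ is recurrent. The enveloping semigroup $E(X)$ is the closure of $\{T^i : i \in \mathbb{Z}\}$ in $X^X$ (product topology), regarded as a cascade under $T_* : p \mapsto T\circ p$. $(X,T)$ is weakly rigid if $\mathrm{Id}_X$ is a recurrent point of $(E(X),T_* )$. An invariant subset $A\subset X$ is isolated if there is a closed set $U\subset X$ containing $A$ in its interior such that $A=\bigcap_{n\in\mathbb{Z}}T^n(U)$ (equivalently, $A$ is the maximum closed invariant subset of $U$). Connected means not the union of two disjoint nonempty open subsets. *)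

theory Defs
  imports "HOL-Analysis.Analysis"
begin

definition cascade :: "'a topology \<Rightarrow> ('a \<Rightarrow> 'a) \<Rightarrow> bool" where
  "cascade X T \<longleftrightarrow> compact_space X \<and> Hausdorff_space X \<and> homeomorphic_map X X T"

text \<open>The power \<open>T\<^sup>i\<close> for an integer \<open>i\<close>. It is meaningful only for a bijection \<open>T\<close> of the carrier,
  and only at points of the carrier.\<close>

definition iterate :: "'a topology \<Rightarrow> ('a \<Rightarrow> 'a) \<Rightarrow> int \<Rightarrow> 'a \<Rightarrow> 'a" where
  "iterate X T i =
     (if 0 \<le> i then T ^^ nat i else inv_into (topspace X) T ^^ nat (- i))"

definition transitive :: "'a topology \<Rightarrow> ('a \<Rightarrow> 'a) \<Rightarrow> bool" where
  "transitive X T \<longleftrightarrow>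
     (\<forall>U V. openin X U \<and> U \<noteq> {} \<and> openin X V \<and> V \<noteq> {} \<longrightarrow>
        (\<exists>i. U \<inter> iterate X T (- i) ` V \<noteq> {}))"

definition weakly_mixing :: "'a topology \<Rightarrow> ('a \<Rightarrow> 'a) \<Rightarrow> bool" where
  "weakly_mixing X T \<longleftrightarrow> transitive (prod_topology X X) (map_prod T T)"

definition omega_limit :: "'a topology \<Rightarrow> ('a \<Rightarrow> 'a) \<Rightarrow> 'a \<Rightarrow> 'a set" where
  "omega_limit Y S y = (\<Inter>N\<in>{1..}. Y closure_of {iterate Y S i y | i. N \<le> i})"

definition alpha_limit :: "'a topology \<Rightarrow> ('a \<Rightarrow> 'a) \<Rightarrow> 'a \<Rightarrow> 'a set" where
  "alpha_limit Y S y = (\<Inter>N\<in>{1..}. Y closure_of {iterate Y S i y | i. i \<le> - N})"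

definition recurrent :: "'a topology \<Rightarrow> ('a \<Rightarrow> 'a) \<Rightarrow> 'a \<Rightarrow> bool" where
  "recurrent Y S y \<longleftrightarrow> y \<in> alpha_limit Y S y \<union> omega_limit Y S y"

definition pointwise_recurrent :: "'a topology \<Rightarrow> ('a \<Rightarrow> 'a) \<Rightarrow> bool" where
  "pointwise_recurrent Y S \<longleftrightarrow> (\<forall>y\<in>topspace Y. recurrent Y S y)"

text \<open>The points of \<open>product_topology (\<lambda>_. X) (topspace X)\<close>, that is of \<open>X\<^sup>X\<close>, are the self-maps of
  the carrier that are \<^const>\<open>undefined\<close> outside it. Hence \<open>T\<^sup>i\<close> and the identity are restricted
  below, and \<open>p \<mapsto> T \<circ> p\<close> is rendered by \<^const>\<open>compose\<close>.\<close>

definition enveloping_semigroup :: "'a topology \<Rightarrow> ('a \<Rightarrow> 'a) \<Rightarrow> ('a \<Rightarrow> 'a) topology" where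
  "enveloping_semigroup X T =
     (let P = product_topology (\<lambda>_. X) (topspace X)
      in subtopology P (P closure_of range (\<lambda>i. restrict (iterate X T i) (topspace X))))"

definition weakly_rigid :: "'a topology \<Rightarrow> ('a \<Rightarrow> 'a) \<Rightarrow> bool" where
  "weakly_rigid X T \<longleftrightarrow>
     recurrent (enveloping_semigroup X T) (compose (topspace X) T) (restrict id (topspace X))"

definition invariant :: "'a topology \<Rightarrow> ('a \<Rightarrow> 'a) \<Rightarrow> 'a set \<Rightarrow> bool" where
  "invariant X T A \<longleftrightarrow> A \<subseteq> topspace X \<and> T ` A = A"

definition isolated_invariant :: "'a topology \<Rightarrow> ('a \<Rightarrow> 'a) \<Rightarrow> 'a set \<Rightarrow> bool" where
  "isolated_invariant X T A \<longleftrightarrow> invariant X T A \<and>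
     (\<exists>U. closedin X U \<and> A \<subseteq> X interior_of U \<and> A = (\<Inter>n. iterate X T n ` U))"

end

theory Submission
  imports Defs
begin

text \<open>
  The heart of the matter is one compactness argument.  Let \<open>A\<close> be the set of all points whose whole
  orbit stays in a closed set \<open>U\<close>, and let \<open>U\<close> be a neighbourhood of \<open>A\<close>.  If every point whose
  forward orbit stays in \<open>U\<close> already lies in \<open>A\<close>, then by compactness \<open>A\<close> is a repeller: it has
  arbitrarily small closed neighbourhoods \<open>W\<close> that are mapped into themselves by \<open>T\<^sup>-\<^sup>1\<close>.  An
  interior point of \<open>W\<close> outside \<open>A\<close> leaves \<open>W\<close> for good in the future and converges to \<open>A\<close> in the
  past, so it is not recurrent.  Hence if all points are recurrent, then either \<open>A\<close> is open or some point outside \<open>A\<close> has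
  its forward orbit in \<open>U\<close> (lemma \<open>trapped_point\<close>).

  For a transitive cascade and a nonempty proper isolated closed set \<open>A\<close>, openness is impossible,
  because then \<open>A\<close> and its complement would be disjoint invariant open sets.  Both time directions
  therefore supply a trapped point: \<open>y\<close> with forward orbit in \<open>U\<close> and \<open>z\<close> with backward orbit in \<open>U\<close>,
  neither of them in \<open>A\<close>.  Now \<open>\<omega>(y) \<subseteq> A\<close> and \<open>\<alpha>(z) \<subseteq> A\<close>.  If the pair \<open>(y, z)\<close> returned to itself
  in the future, so would \<open>y\<close>; if it returned in the past, so would \<open>z\<close>.  Neither can happen, so
  \<open>(y, z)\<close> is not recurrent.  Pointwise recurrence of the square is used exactly here, to force two
  points to return in the same time direction.

  Weak rigidity gives such simultaneous returns for any family of points, because evaluation at the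
  members of the family is continuous on the enveloping semigroup; in particular it gives them for
  four points, that is for pairs of points of \<open>X \<times> X\<close>.  So if \<open>X \<times> X\<close> is transitive, the first part
  applies to it.  A partition of \<open>X\<close> into clopen sets \<open>B\<close> and \<open>C\<close> would make
  \<open>B \<times> B \<union> C \<times> C\<close> a clopen neighbourhood of the diagonal, and the largest invariant set inside it
  would be isolated, nonempty and proper.
\<close>

section \<open>Integer flows and their limit sets\<close>

locale integer_flow =
  fixes X :: "'a topology" and \<phi> :: "int \<Rightarrow> 'a \<Rightarrow> 'a"
  assumes continuous: "continuous_map X X (\<phi> i)"
    and zero: "x \<in> topspace X \<Longrightarrow> \<phi> 0 x = x"
    and add: "x \<in> topspace X \<Longrightarrow> \<phi> (i + j) x = \<phi> i (\<phi> j x)"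

text \<open>For the iterates of a cascade this is the \<open>\<omega>\<close>-limit set, and for the time-reversed flow the
  \<open>\<alpha>\<close>-limit set, so that both can be treated at once.\<close>

definition forward_limit :: "'a topology \<Rightarrow> (int \<Rightarrow> 'a \<Rightarrow> 'a) \<Rightarrow> 'a \<Rightarrow> 'a set" where
  "forward_limit X \<phi> x = (\<Inter>N\<in>{1..}. X closure_of {\<phi> i x | i. N \<le> i})"

lemma omega_limit_eq: "omega_limit X T = forward_limit X (iterate X T)"
  by (simp add: omega_limit_def forward_limit_def fun_eq_iff)

lemma alpha_limit_eq: "alpha_limit X T = forward_limit X (\<lambda>i. iterate X T (- i))"
proof -
  have "{iterate X T i y | i. i \<le> - N} = {iterate X T (- i) y | i. N \<le> i}" for N y
    by (auto; metis minus_minus neg_le_iff_le)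
  then show ?thesis
    by (simp add: alpha_limit_def forward_limit_def fun_eq_iff)
qed

lemma recurrent_iff_forward_limit:
  "recurrent X T x \<longleftrightarrow>
     x \<in> forward_limit X (\<lambda>i. iterate X T (- i)) x \<union> forward_limit X (iterate X T) x"
  by (simp add: recurrent_def alpha_limit_eq omega_limit_eq)

lemma forward_limit_continuous_image:
  assumes "continuous_map X Y f" and "\<And>i. f (\<phi> i x) = \<psi> i (f x)"
    and "p \<in> forward_limit X \<phi> x"
  shows "f p \<in> forward_limit Y \<psi> (f x)"
proof -
  have "f p \<in> Y closure_of {\<psi> i (f x) | i. N \<le> i}" if "N \<ge> 1" for N
  proof -
    have "p \<in> X closure_of {\<phi> i x | i. N \<le> i}"
      using INT_D[OF assms(3)[unfolded forward_limit_def], of N] that by simp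
    then have "f p \<in> Y closure_of f ` {\<phi> i x | i. N \<le> i}"
      using continuous_map_image_closure_subset[OF assms(1)] by fast
    moreover have "f ` {\<phi> i x | i. N \<le> i} = {\<psi> i (f x) | i. N \<le> i}"
      unfolding assms(2)[symmetric] by blast
    ultimately show ?thesis
      by simp
  qed
  then show ?thesis
    by (simp add: forward_limit_def)
qed

context integer_flow
begin

lemma in_topspace [simp]: "x \<in> topspace X \<Longrightarrow> \<phi> i x \<in> topspace X"
  using continuous[of i] by (auto simp: continuous_map_def)

lemma reverse: "integer_flow X (\<lambda>i. \<phi> (- i))"
proof
  show "x \<in> topspace X \<Longrightarrow> \<phi> (- (i + j)) x = \<phi> (- i) (\<phi> (- j) x)" for x i j
    using add[of x "- i" "- j"] by simp
qed (auto simp: continuous zero)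

text \<open>A limit point of a forward orbit in \<open>U\<close> is a limit of orbit segments in \<open>U\<close> that extend further
  and further in both directions, so its whole orbit stays in \<open>U\<close>.\<close>

lemma forward_limit_trapped:
  assumes "closedin X U" and x: "x \<in> topspace X" and "\<And>i. 0 \<le> i \<Longrightarrow> \<phi> i x \<in> U"
    and p: "p \<in> forward_limit X \<phi> x"
  shows "\<phi> n p \<in> U"
proof -
  let ?N = "max 1 (- n)"
  have "p \<in> X closure_of {\<phi> i x | i. ?N \<le> i}"
    using INT_D[OF p[unfolded forward_limit_def], of ?N] by simp
  then have "\<phi> n p \<in> X closure_of \<phi> n ` {\<phi> i x | i. ?N \<le> i}"
    using continuous_map_image_closure_subset[OF continuous] by fast
  moreover have "\<phi> n ` {\<phi> i x | i. ?N \<le> i} \<subseteq> U"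
    using assms(3) x by (auto simp flip: add)
  ultimately show ?thesis
    using closure_of_minimal[OF _ assms(1)] by blast
qed

text \<open>If no point were trapped, the sets \<open>W n\<close> of the points that stay in \<open>U\<close> up to time \<open>n\<close> would
  decrease to \<open>A\<close>; some \<open>W n\<close> would then be mapped into itself in backward time, and no point of
  its interior outside \<open>A\<close> could be recurrent.  So \<open>A\<close> would be that interior, hence open.\<close>

lemma trapped_point:
  assumes compact: "compact_space X" and U: "closedin X U"
    and A: "A = {x \<in> topspace X. \<forall>i. \<phi> i x \<in> U}" and "A \<subseteq> X interior_of U"
    and "\<not> openin X A"
    and recurrent: "\<And>x. x \<in> topspace X \<Longrightarrow>
      x \<in> forward_limit X (\<lambda>i. \<phi> (- i)) x \<union> forward_limit X \<phi> x"
  obtains y where "y \<in> topspace X" "y \<notin> A" "\<And>i. 0 \<le> i \<Longrightarrow> \<phi> i y \<in> U"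
proof (rule ccontr)
  assume "\<not> thesis"
  then have leaves: "x \<in> topspace X \<Longrightarrow> x \<notin> A \<Longrightarrow> \<exists>i\<ge>0. \<phi> i x \<notin> U" for x
    using that by blast
  define W where "W n = (\<Inter>i\<in>{0..int n}. {x \<in> topspace X. \<phi> i x \<in> U})" for n
  define G where "G = {x \<in> topspace X. \<phi> (- 1) x \<in> X interior_of U}"
  have W_iff: "x \<in> W n \<longleftrightarrow> x \<in> topspace X \<and> (\<forall>i. 0 \<le> i \<and> i \<le> int n \<longrightarrow> \<phi> i x \<in> U)" for x n
    by (force simp: W_def)
  have A_inv: "\<phi> i x \<in> A" if "x \<in> A" for i x
    using that by (auto simp: A simp flip: add)
  have "openin X G"
    unfolding G_def by (rule openin_continuous_map_preimage[OF continuous]) simp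
  have "A \<subseteq> G"
    using A_inv assms(4) by (auto simp: G_def A)
  obtain n where n: "W n \<subseteq> G"
  proof (rule ccontr)
    assume "\<not> thesis"
    then have "\<forall>n. W n - G \<noteq> {}"
      using that by blast
    moreover have "closedin X (W n)" for n
      unfolding W_def
      by (intro closedin_INT closedin_continuous_map_preimage[OF continuous U]) simp
    then have "\<forall>n. closedin X (W n - G)"
      using closedin_diff[OF _ \<open>openin X G\<close>] by simp
    moreover have "decseq (\<lambda>n. W n - G)"
    proof (intro decseq_SucI Diff_mono subset_refl)
      show "W (Suc n) \<subseteq> W n" for n
        by (simp add: W_iff subset_iff)
    qed
    ultimately have "(\<Inter>n. W n - G) \<noteq> {}"
      by (intro compact_space_imp_nest[OF compact]) auto
    then obtain x where x: "\<And>n. x \<in> W n" "x \<notin> G"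
      by blast
    have "\<phi> i x \<in> U" if "0 \<le> i" for i
      using x(1)[of "nat i"] that by (auto simp: W_iff)
    then show False
      using leaves x \<open>A \<subseteq> G\<close> by (metis W_iff subsetD)
  qed
  \<comment> \<open>Times \<open>1\<close> to \<open>n\<close> of \<open>\<phi> (- 1) x\<close> are times \<open>0\<close> to \<open>n - 1\<close> of \<open>x\<close>; its time \<open>0\<close> is covered by \<open>G\<close>.\<close>
  have W_step: "\<phi> (- 1) x \<in> W n" if x: "x \<in> W n" for x
  proof -
    have "\<phi> i (\<phi> (- 1) x) \<in> U" if "0 \<le> i" "i \<le> int n" for i
    proof (cases "i = 0")
      case True
      with n x have "\<phi> (- 1) x \<in> U"
        using interior_of_subset[of X U] by (auto simp: G_def)
      then show ?thesis
        using x True by (simp add: zero W_iff)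
    next
      case False
      with x that have "\<phi> (i - 1) x \<in> U"
        by (simp add: W_iff)
      then show ?thesis
        using x add[of x i "- 1"] by (simp add: W_iff)
    qed
    with x show ?thesis
      by (simp add: W_iff)
  qed
  have W_back: "\<phi> (- int k) x \<in> W n" if x: "x \<in> W n" for x k
  proof (induction k)
    case 0
    then show ?case
      using x by (auto simp: zero W_iff)
  next
    case (Suc k)
    have "\<phi> (- int (Suc k)) x = \<phi> (- 1) (\<phi> (- int k) x)"
      using x add[of x "- 1" "- int k"] by (simp add: W_iff)
    with W_step[OF Suc] show ?case
      by simp
  qed
  have "X interior_of W n \<subseteq> A"
  proof
    fix x
    assume xint: "x \<in> X interior_of W n"
    then have xW: "x \<in> W n"
      using interior_of_subset by fast
    then have x: "x \<in> topspace X"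
      by (simp add: W_iff)
    show "x \<in> A"
    proof (rule ccontr)
      assume "x \<notin> A"
      then obtain j where j: "j \<ge> 0" "\<phi> j x \<notin> U"
        using leaves x by blast
      \<comment> \<open>Backward invariance means that an orbit which has left \<open>W n\<close> cannot come back.\<close>
      have out: "\<phi> m x \<notin> W n" if "m \<ge> j" for m
      proof
        assume "\<phi> m x \<in> W n"
        then have "\<phi> (- int (nat (m - j))) (\<phi> m x) \<in> W n"
          by (rule W_back)
        moreover have "\<phi> (- int (nat (m - j))) (\<phi> m x) = \<phi> j x"
          using x that by (simp flip: add)
        ultimately have "\<phi> 0 (\<phi> j x) \<in> U"
          by (simp only: W_iff) auto
        then show False
          using j x by (simp add: zero)
      qed
      have "x \<notin> forward_limit X \<phi> x"
      proof
        assume "x \<in> forward_limit X \<phi> x"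
        then have "x \<in> X closure_of {\<phi> i x | i. max 1 j \<le> i}"
          unfolding forward_limit_def by (rule INT_D) simp
        then obtain i where "max 1 j \<le> i" "\<phi> i x \<in> X interior_of W n"
          using xint openin_interior_of[of X "W n"] unfolding in_closure_of by blast
        then show False
          using out interior_of_subset[of X "W n"] by auto
      qed
      then have "x \<in> forward_limit X (\<lambda>i. \<phi> (- i)) x"
        using recurrent x by blast
      moreover have "\<phi> (- i) x \<in> U" if "0 \<le> i" for i
      proof -
        have "\<phi> 0 (\<phi> (- i) x) \<in> U"
          using W_back[OF xW, of "nat i"] that by (simp add: W_iff)
        then show ?thesis
          using x by (simp add: zero)
      qed
      ultimately have "\<phi> (- i) x \<in> U" for i
        using integer_flow.forward_limit_trapped[OF reverse U x] by blast
      then have "\<phi> i x \<in> U" for i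
        by (metis minus_minus)
      then have "x \<in> A"
        using x by (simp add: A)
      with \<open>x \<notin> A\<close> show False ..
    qed
  qed
  moreover have "A \<subseteq> X interior_of W n"
  proof -
    let ?O = "topspace X \<inter> (\<Inter>i\<in>{0..int n}. {x \<in> topspace X. \<phi> i x \<in> X interior_of U})"
    have "openin X ?O"
      by (auto intro!: openin_Int openin_continuous_map_preimage[OF continuous] openin_INT2)
    moreover have "?O \<subseteq> W n"
      using interior_of_subset[of X U] by (fastforce simp: W_iff)
    moreover have "A \<subseteq> ?O"
      using A_inv assms(4) by (auto simp: A)
    ultimately show ?thesis
      by (meson interior_of_maximal subset_trans)
  qed
  ultimately show False
    using assms(5) by (metis openin_interior_of subset_antisym)
qed

end

section \<open>Iterates of a cascade\<close>

text \<open>For injective \<open>S\<close>, a two-sided sequence in the carrier along which \<open>S\<close> moves by one step is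
  determined by its term at time \<open>0\<close>.  Stated for iterates, this identifies orbits in products and in
  the enveloping semigroup without computing the inverse maps there.\<close>

lemma iterate_eqI:
  assumes "inj_on S (topspace Y)" and "\<And>i. g i \<in> topspace Y" and "\<And>i. S (g i) = g (i + 1)"
  shows "iterate Y S i (g 0) = g i"
proof -
  have "(S ^^ n) (g 0) = g (int n)" for n
    by (induction n) (simp_all add: assms(3) add.commute)
  moreover have "(inv_into (topspace Y) S ^^ n) (g 0) = g (- int n)" for n
  proof (induction n)
    case (Suc n)
    have "inv_into (topspace Y) S (g (- int n)) = g (- int n - 1)"
      using assms(2) assms(3)[of "- int n - 1"] inv_into_f_f[OF assms(1), of "g (- int n - 1)"] by simp
    moreover have "- int (Suc n) = - int n - 1"
      by linarith
    ultimately show ?case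
      using Suc by (metis comp_apply funpow.simps(2))
  qed simp
  ultimately show ?thesis
    by (simp add: iterate_def)
qed

context
  fixes X :: "'a topology" and T :: "'a \<Rightarrow> 'a"
  assumes cascade: "cascade X T"
begin

lemma cascade_inj: "inj_on T (topspace X)"
  using cascade homeomorphic_imp_injective_map by (auto simp: cascade_def)

lemma continuous_map_iterate: "continuous_map X X (iterate X T i)"
proof -
  have T: "homeomorphic_map X X T"
    using cascade by (simp add: cascade_def)
  then obtain R where R: "homeomorphic_maps X X T R"
    by (auto simp: homeomorphic_map_maps)
  have "continuous_map X X (inv_into (topspace X) T)"
  proof (rule continuous_map_eq)
    show "continuous_map X X R"
      using R by (simp add: homeomorphic_maps_def)
    show "R x = inv_into (topspace X) T x" if "x \<in> topspace X" for x
      using R that cascade_inj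
      by (metis homeomorphic_maps_def inv_into_f_eq continuous_map_image_subset_topspace image_subset_iff)
  qed
  moreover have "continuous_map X X T"
    using T by (rule homeomorphic_imp_continuous_map)
  moreover have "continuous_map X X (f ^^ n)" if "continuous_map X X f" for f :: "'a \<Rightarrow> 'a" and n
    by (induction n) (use continuous_map_compose[OF _ that] in \<open>auto simp: o_def\<close>)
  ultimately show ?thesis
    by (simp add: iterate_def)
qed

lemma iterate_in_topspace: "x \<in> topspace X \<Longrightarrow> iterate X T i x \<in> topspace X"
  using continuous_map_iterate[of i] by (auto simp: continuous_map_def)

lemma iterate_step:
  assumes "x \<in> topspace X"
  shows "T (iterate X T i x) = iterate X T (i + 1) x"
proof (cases "0 \<le> i")
  case True
  then show ?thesis
    by (simp add: iterate_def nat_add_distrib)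
next
  case False
  then obtain n where i: "i = - int (Suc n)"
    by (metis int_cases2 neg_equal_0_iff_equal not0_implies_Suc of_nat_0 of_nat_0_le_iff)
  have "iterate X T (- int n) x \<in> T ` topspace X"
    using iterate_in_topspace[OF assms] cascade homeomorphic_imp_surjective_map by (fastforce simp: cascade_def)
  then have "T (inv_into (topspace X) T (iterate X T (- int n) x)) = iterate X T (- int n) x"
    by (rule f_inv_into_f)
  then show ?thesis
    by (cases "n = 0") (auto simp: i iterate_def nat_add_distrib)
qed

lemma integer_flow_iterate: "integer_flow X (iterate X T)"
proof
  show "iterate X T 0 x = x" for x
    by (simp add: iterate_def)
  show "iterate X T (i + j) x = iterate X T i (iterate X T j x)" if "x \<in> topspace X" for x i j
  proof -
    let ?g = "\<lambda>i. iterate X T (i + j) x"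
    have "T (?g i) = ?g (i + 1)" for i
      using iterate_step[OF that, of "i + j"] by (simp add: ac_simps)
    then have "iterate X T i (?g 0) = ?g i"
      using iterate_eqI[OF cascade_inj, of ?g] iterate_in_topspace[OF that] by blast
    then show ?thesis
      by simp
  qed
qed (rule continuous_map_iterate)

lemma image_iterate:
  assumes "U \<subseteq> topspace X"
  shows "iterate X T n ` U = {x \<in> topspace X. iterate X T (- n) x \<in> U}"
proof -
  interpret integer_flow X "iterate X T"
    by (rule integer_flow_iterate)
  have cancel: "iterate X T (- i) (iterate X T i x) = x" if "x \<in> topspace X" for i x
    using that by (simp add: zero flip: add)
  show ?thesis
  proof (intro subset_antisym subsetI)
    fix x
    assume "x \<in> iterate X T n ` U"
    then obtain u where "u \<in> U" "x = iterate X T n u"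
      by blast
    then show "x \<in> {x \<in> topspace X. iterate X T (- n) x \<in> U}"
      using assms cancel[of u n] by (simp add: subsetD iterate_in_topspace)
  next
    fix x
    assume "x \<in> {x \<in> topspace X. iterate X T (- n) x \<in> U}"
    then show "x \<in> iterate X T n ` U"
      using cancel[of x "- n"] by (metis (mono_tags, lifting) imageI mem_Collect_eq minus_minus)
  qed
qed

lemma Inter_image_iterate:
  assumes "U \<subseteq> topspace X"
  shows "(\<Inter>n. iterate X T n ` U) = {x \<in> topspace X. \<forall>i. iterate X T i x \<in> U}"
proof -
  have "(\<forall>n. iterate X T (- n) x \<in> U) \<longleftrightarrow> (\<forall>i. iterate X T i x \<in> U)" for x
    by (metis minus_minus)
  then show ?thesis
    unfolding image_iterate[OF assms] by blast
qed

lemma iterate_prod: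
  assumes "x \<in> topspace X" and "y \<in> topspace X"
  shows "iterate (prod_topology X X) (map_prod T T) i (x, y) = (iterate X T i x, iterate X T i y)"
proof -
  have "inj_on (map_prod T T) (topspace (prod_topology X X))"
    using cascade_inj by (auto simp: map_prod_inj_on)
  then have "iterate (prod_topology X X) (map_prod T T) i (iterate X T 0 x, iterate X T 0 y) =
      (iterate X T i x, iterate X T i y)"
    by (rule iterate_eqI[where g = "\<lambda>i. (iterate X T i x, iterate X T i y)"])
       (use assms in \<open>auto simp: iterate_in_topspace iterate_step\<close>)
  then show ?thesis
    by (simp add: iterate_def)
qed

lemma cascade_prod: "cascade (prod_topology X X) (map_prod T T)"
proof -
  obtain R where "homeomorphic_maps X X T R"
    using cascade by (auto simp: cascade_def homeomorphic_map_maps)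
  then have "homeomorphic_maps (prod_topology X X) (prod_topology X X)
      (\<lambda>(x, y). (T x, T y)) (\<lambda>(x, y). (R x, R y))"
    by (simp add: homeomorphic_maps_prod)
  then have "homeomorphic_map (prod_topology X X) (prod_topology X X) (map_prod T T)"
    by (auto simp: homeomorphic_map_maps map_prod_def)
  then show ?thesis
    using cascade
    by (simp add: cascade_def compact_space_prod_topology Hausdorff_space_prod_topology)
qed

section \<open>Simultaneous recurrence\<close>

lemma iterate_enveloping_semigroup:
  "iterate (enveloping_semigroup X T) (compose (topspace X) T) i (restrict id (topspace X)) =
   restrict (iterate X T i) (topspace X)"
proof -
  let ?E = "enveloping_semigroup X T"
  let ?g = "\<lambda>i. restrict (iterate X T i) (topspace X)"
  have "inj_on (compose (topspace X) T) (topspace ?E)"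
  proof (rule inj_onI)
    fix p q
    assume "p \<in> topspace ?E" "q \<in> topspace ?E"
      and eq: "compose (topspace X) T p = compose (topspace X) T q"
    then have pq: "p \<in> (topspace X) \<rightarrow>\<^sub>E topspace X" "q \<in> (topspace X) \<rightarrow>\<^sub>E topspace X"
      by (auto simp: enveloping_semigroup_def Let_def)
    show "p = q"
    proof (rule PiE_ext[OF pq])
      fix x
      assume x: "x \<in> topspace X"
      then have "T (p x) = T (q x)"
        using eq by (metis compose_eq)
      then show "p x = q x"
        using cascade_inj pq x by (auto simp: inj_on_def PiE_iff)
    qed
  qed
  moreover have "?g i \<in> topspace ?E" for i
  proof -
    let ?P = "product_topology (\<lambda>_. X) (topspace X)"
    have "range ?g \<subseteq> topspace ?P"
      by (auto simp: iterate_in_topspace)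
    then have "range ?g \<subseteq> ?P closure_of range ?g"
      by (rule closure_of_subset)
    then show ?thesis
      using \<open>range ?g \<subseteq> topspace ?P\<close>
      unfolding enveloping_semigroup_def Let_def topspace_subtopology by blast
  qed
  moreover have "compose (topspace X) T (?g i) = ?g (i + 1)" for i
    by (auto simp: compose_def iterate_step)
  ultimately have "iterate ?E (compose (topspace X) T) i (?g 0) = ?g i"
    by (rule iterate_eqI)
  then show ?thesis
    by (simp add: iterate_def id_def)
qed

text \<open>In the applications \<open>f\<close> evaluates at several points, and the conclusion says that these points
  return simultaneously.\<close>

lemma weakly_rigid_imp_recurrent:
  assumes "weakly_rigid X T"
    and "continuous_map (product_topology (\<lambda>_. X) (topspace X)) Y f"
    and "\<And>i. f (restrict (iterate X T i) (topspace X)) = iterate Y S i (f (restrict id (topspace X)))"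
  shows "recurrent Y S (f (restrict id (topspace X)))"
proof -
  have "continuous_map (enveloping_semigroup X T) Y f"
    using assms(2) by (simp add: enveloping_semigroup_def Let_def continuous_map_from_subtopology)
  note image = forward_limit_continuous_image[OF this, where x = "restrict id (topspace X)"]
  have "f (restrict id (topspace X)) \<in>
      forward_limit Y (\<lambda>i. iterate Y S (e i)) (f (restrict id (topspace X)))"
    if "restrict id (topspace X) \<in> forward_limit (enveloping_semigroup X T)
      (\<lambda>i. iterate (enveloping_semigroup X T) (compose (topspace X) T) (e i))
      (restrict id (topspace X))" for e
    by (rule image[OF _ that]) (simp add: iterate_enveloping_semigroup assms(3))
  from this[of uminus] this[of "\<lambda>i. i"] show ?thesis
    using assms(1) by (auto simp: weakly_rigid_def recurrent_iff_forward_limit)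
qed

lemma weakly_rigid_imp_square_recurrent:
  assumes "weakly_rigid X T"
  shows "pointwise_recurrent (prod_topology X X) (map_prod T T)"
  unfolding pointwise_recurrent_def
proof clarsimp
  fix x y
  assume xy: "x \<in> topspace X" "y \<in> topspace X"
  have "recurrent (prod_topology X X) (map_prod T T)
      ((\<lambda>p. (p x, p y)) (restrict id (topspace X)))"
    using xy
    by (intro weakly_rigid_imp_recurrent[OF assms])
       (auto intro!: continuous_map_pairedI continuous_map_product_projection simp: iterate_prod)
  then show "recurrent (prod_topology X X) (map_prod T T) (x, y)"
    using xy by simp
qed

end

lemma weakly_rigid_imp_fourth_power_recurrent:
  assumes "cascade X T" and "weakly_rigid X T"
  shows "pointwise_recurrent (prod_topology (prod_topology X X) (prod_topology X X))
    (map_prod (map_prod T T) (map_prod T T))"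
  unfolding pointwise_recurrent_def
proof clarsimp
  fix a b c d
  assume abcd: "a \<in> topspace X" "b \<in> topspace X" "c \<in> topspace X" "d \<in> topspace X"
  have "recurrent (prod_topology (prod_topology X X) (prod_topology X X))
      (map_prod (map_prod T T) (map_prod T T))
      ((\<lambda>p. ((p a, p b), (p c, p d))) (restrict id (topspace X)))"
    using abcd assms(1)
    by (intro weakly_rigid_imp_recurrent[OF assms])
       (auto intro!: continuous_map_pairedI continuous_map_product_projection
          simp: iterate_prod[OF cascade_prod] iterate_prod)
  then show "recurrent (prod_topology (prod_topology X X) (prod_topology X X))
      (map_prod (map_prod T T) (map_prod T T)) ((a, b), (c, d))"
    using abcd by simp
qed

text \<open>Projections send limit points of an orbit to limit points of the projected orbit in the same
  time direction.  The gain over recurrence of \<open>x\<close> and of \<open>y\<close> is that one direction serves both.\<close>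

lemma square_recurrent_pair:
  assumes "cascade X T" and "pointwise_recurrent (prod_topology X X) (map_prod T T)"
    and "x \<in> topspace X" "y \<in> topspace X"
  shows "x \<in> forward_limit X (\<lambda>i. iterate X T (- i)) x \<and>
         y \<in> forward_limit X (\<lambda>i. iterate X T (- i)) y \<or>
         x \<in> forward_limit X (iterate X T) x \<and> y \<in> forward_limit X (iterate X T) y"
proof -
  let ?Q = "prod_topology X X"
  have coords: "x \<in> forward_limit X (\<lambda>i. iterate X T (e i)) x \<and>
      y \<in> forward_limit X (\<lambda>i. iterate X T (e i)) y"
    if lim: "(x, y) \<in> forward_limit ?Q (\<lambda>i. iterate ?Q (map_prod T T) (e i)) (x, y)" for e
  proof -
    have "fst (x, y) \<in> forward_limit X (\<lambda>i. iterate X T (e i)) (fst (x, y))"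
      by (rule forward_limit_continuous_image[OF continuous_map_fst _ lim])
         (simp add: iterate_prod[OF assms(1,3,4)])
    moreover have "snd (x, y) \<in> forward_limit X (\<lambda>i. iterate X T (e i)) (snd (x, y))"
      by (rule forward_limit_continuous_image[OF continuous_map_snd _ lim])
         (simp add: iterate_prod[OF assms(1,3,4)])
    ultimately show ?thesis
      by simp
  qed
  have "recurrent ?Q (map_prod T T) (x, y)"
    using assms(2-4) by (simp add: pointwise_recurrent_def)
  then show ?thesis
    using coords[of uminus] coords[of "\<lambda>i. i"] by (auto simp: recurrent_iff_forward_limit)
qed

section \<open>Isolated invariant sets\<close>

lemma transitive_no_clopen_invariant:
  assumes "cascade X T" "transitive X T" "openin X A" "closedin X A" "A \<noteq> {}" "A \<noteq> topspace X"
    and inv: "\<And>x i. x \<in> A \<Longrightarrow> iterate X T i x \<in> A"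
  shows False
proof -
  have "openin X (topspace X - A)" "topspace X - A \<noteq> {}"
    using assms closedin_subset[OF assms(4)] by auto
  then obtain i where "A \<inter> iterate X T (- i) ` (topspace X - A) \<noteq> {}"
    using assms(2,3,5) unfolding transitive_def by meson
  then obtain x where x: "x \<in> topspace X" "x \<notin> A" "iterate X T (- i) x \<in> A"
    by blast
  interpret integer_flow X "iterate X T"
    by (rule integer_flow_iterate[OF assms(1)])
  have "iterate X T i (iterate X T (- i) x) = x"
    using x(1) by (simp add: zero flip: add)
  then show False
    using inv[OF x(3), of i] x(2) by simp
qed

text \<open>A trapped point exists in each time direction, and the pair of the two has no common direction
  in which it could return.\<close>

lemma no_isolated_invariant:
  assumes "cascade X T" "transitive X T"
    and rec: "pointwise_recurrent (prod_topology X X) (map_prod T T)"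
    and "A \<noteq> {}" "A \<noteq> topspace X" "closedin X A"
  shows "\<not> isolated_invariant X T A"
proof
  assume "isolated_invariant X T A"
  then obtain U where U: "closedin X U" "A \<subseteq> X interior_of U" "A = (\<Inter>n. iterate X T n ` U)"
    by (auto simp: isolated_invariant_def)
  interpret fwd: integer_flow X "iterate X T"
    by (rule integer_flow_iterate[OF assms(1)])
  interpret bwd: integer_flow X "\<lambda>i. iterate X T (- i)"
    by (rule fwd.reverse)
  have A: "A = {x \<in> topspace X. \<forall>i. iterate X T i x \<in> U}"
    using Inter_image_iterate[OF assms(1) closedin_subset[OF U(1)]] U(3) by simp
  moreover have "(\<forall>i. iterate X T i x \<in> U) \<longleftrightarrow> (\<forall>i. iterate X T (- i) x \<in> U)" for x
    by (metis minus_minus)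
  ultimately have A': "A = {x \<in> topspace X. \<forall>i. iterate X T (- i) x \<in> U}"
    by simp
  have "\<not> openin X A"
  proof
    assume "openin X A"
    moreover have "iterate X T i x \<in> A" if "x \<in> A" for x i
      using that by (auto simp: A simp flip: fwd.add)
    ultimately show False
      using transitive_no_clopen_invariant assms by blast
  qed
  have compact: "compact_space X"
    using assms(1) by (simp add: cascade_def)
  note pair = square_recurrent_pair[OF assms(1) rec]
  obtain y where y: "y \<in> topspace X" "y \<notin> A" "\<And>i. 0 \<le> i \<Longrightarrow> iterate X T i y \<in> U"
    by (rule fwd.trapped_point[OF compact U(1) A U(2) \<open>\<not> openin X A\<close>]) (use pair in blast)+
  obtain z where z: "z \<in> topspace X" "z \<notin> A" "\<And>i. 0 \<le> i \<Longrightarrow> iterate X T (- i) z \<in> U"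
    by (rule bwd.trapped_point[OF compact U(1) A' U(2) \<open>\<not> openin X A\<close>]) (use pair in auto)
  have "y \<notin> forward_limit X (iterate X T) y"
    using fwd.forward_limit_trapped[OF U(1) y(1) y(3)] y(1,2) A by blast
  moreover have "z \<notin> forward_limit X (\<lambda>i. iterate X T (- i)) z"
    using bwd.forward_limit_trapped[OF U(1) z(1) z(3)] z(1,2) A' by blast
  ultimately show False
    using pair[OF y(1) z(1)] by blast
qed

text \<open>Two points stay on the same side of a clopen partition \<open>B\<close>, \<open>C\<close> at all times exactly if their
  pair lies in the isolated set \<open>A\<close> below.  The diagonal makes \<open>A\<close> nonempty and \<open>B \<times> C\<close> makes it
  proper, so a partition contradicts the absence of such sets in the square.\<close>

lemma weakly_rigid_weakly_mixing_imp_connected: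
  assumes "cascade X T" "weakly_rigid X T" "weakly_mixing X T"
  shows "connected_space X"
proof (rule ccontr)
  assume "\<not> connected_space X"
  then obtain B C where BC: "openin X B" "openin X C" "topspace X \<subseteq> B \<union> C" "B \<inter> C = {}"
    "B \<noteq> {}" "C \<noteq> {}"
    by (auto simp: connected_space_def)
  have sub: "B \<subseteq> topspace X" "C \<subseteq> topspace X"
    using BC(1,2) by (auto dest: openin_subset)
  let ?Q = "prod_topology X X" and ?S = "map_prod T T"
  let ?U = "B \<times> B \<union> C \<times> C"
  note Q = cascade_prod[OF assms(1)]
  interpret integer_flow ?Q "iterate ?Q ?S"
    by (rule integer_flow_iterate[OF Q])
  have "openin ?Q ?U"
    using BC by (auto simp: openin_prod_Times_iff)
  moreover have "topspace ?Q - ?U = B \<times> C \<union> C \<times> B"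
    using BC sub by auto
  then have "openin ?Q (topspace ?Q - ?U)"
    using BC by (auto simp: openin_prod_Times_iff)
  then have "closedin ?Q ?U"
    using sub by (auto simp: closedin_def)
  ultimately have U: "openin ?Q ?U" "closedin ?Q ?U" .
  define A where "A = {q \<in> topspace ?Q. \<forall>i. iterate ?Q ?S i q \<in> ?U}"
  have AU: "A = (\<Inter>n. iterate ?Q ?S n ` ?U)"
    unfolding A_def by (rule Inter_image_iterate[OF Q closedin_subset[OF U(2)], symmetric])
  have inv: "iterate ?Q ?S i q \<in> A" if "q \<in> A" for i q
    using that by (auto simp: A_def simp flip: add simp del: topspace_prod_topology)
  have sub_U: "A \<subseteq> ?U"
    by (rule subsetI) (metis (mono_tags, lifting) A_def mem_Collect_eq zero)
  have one: "iterate ?Q ?S 1 = ?S"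
    by (simp add: iterate_def)
  have "?S ` A = A"
  proof
    show "?S ` A \<subseteq> A"
      using inv[of _ 1] by (auto simp: one)
    show "A \<subseteq> ?S ` A"
    proof
      fix q
      assume q: "q \<in> A"
      then have "?S (iterate ?Q ?S (- 1) q) = q"
        using iterate_step[OF Q, of q "- 1"] zero by (simp add: A_def)
      then show "q \<in> ?S ` A"
        using inv[OF q, of "- 1"] by (metis imageI)
    qed
  qed
  moreover have "A \<subseteq> topspace ?Q"
    by (auto simp: A_def)
  ultimately have isolated: "isolated_invariant ?Q ?S A"
    unfolding isolated_invariant_def invariant_def
    using U AU sub_U by (metis interior_of_openin)
  have "closedin ?Q A"
  proof -
    have "A = (\<Inter>i. {q \<in> topspace ?Q. iterate ?Q ?S i q \<in> ?U})"
      by (auto simp: A_def)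
    then show ?thesis
      using closedin_continuous_map_preimage[OF continuous U(2)] by (auto intro!: closedin_INT)
  qed
  moreover have "A \<noteq> {}"
  proof -
    obtain x where x: "x \<in> topspace X"
      using BC(5) sub by blast
    then have "(x, x) \<in> A"
      using BC(3) iterate_in_topspace[OF assms(1)] by (auto simp: A_def iterate_prod[OF assms(1)])
    then show ?thesis
      by blast
  qed
  moreover have "A \<noteq> topspace ?Q"
  proof -
    obtain b c where bc: "b \<in> B" "c \<in> C"
      using BC(5,6) by blast
    then have "(b, c) \<notin> ?U" "(b, c) \<in> topspace ?Q"
      using BC(4) sub by auto
    then show ?thesis
      using sub_U by blast
  qed
  moreover have "transitive ?Q ?S"
    using assms(3) by (simp add: weakly_mixing_def)
  ultimately have "\<not> isolated_invariant ?Q ?S A"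
    by (intro no_isolated_invariant[OF Q] weakly_rigid_imp_fourth_power_recurrent[OF assms(1,2)])
  then show False
    using isolated by contradiction
qed

theorem theorem3p3:
  fixes X :: "'a topology" and T :: "'a \<Rightarrow> 'a"
  assumes "cascade X T" and "transitive X T"
  shows "(weakly_rigid X T \<or> pointwise_recurrent (prod_topology X X) (map_prod T T) \<longrightarrow>
            \<not> (\<exists>A. A \<noteq> {} \<and> A \<noteq> topspace X \<and> closedin X A \<and> isolated_invariant X T A))
       \<and> (weakly_rigid X T \<and> weakly_mixing X T \<longrightarrow> connected_space X)"
proof (intro conjI impI notI)
  assume "weakly_rigid X T \<or> pointwise_recurrent (prod_topology X X) (map_prod T T)"
    and "\<exists>A. A \<noteq> {} \<and> A \<noteq> topspace X \<and> closedin X A \<and> isolated_invariant X T A"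
  moreover from this(1) have "pointwise_recurrent (prod_topology X X) (map_prod T T)"
    using weakly_rigid_imp_square_recurrent[OF assms(1)] by blast
  ultimately show False
    using no_isolated_invariant[OF assms] by blast
next
  assume "weakly_rigid X T \<and> weakly_mixing X T"
  then show "connected_space X"
    using weakly_rigid_weakly_mixing_imp_connected[OF assms(1)] by simp
qed

end
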